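(* Let $k \geq 2$ be an integer and let $\alpha$ be a real number. For an integer $n \geq 0$ let $|\tau(n)|$ denote the length of the standard base-$k$ representation of $n$, i.e., $|\tau(0)| = 0$ and $|\tau(n)| = \lfloor \log_k n \rfloor + 1$ for $n \geq 1$. Then the formal power series $$f(x) = \sum_{n \geq 0} \left\lfloor \alpha + \log_k (n+1) \right\rfloor x^{|\tau(n)|}$$ in one variable $x$ is rational if and only if $k^\alpha$ is rational.
   Context: For each $m \geq 0$ only finitely many $n$ satisfy $|\tau(n)| = m$, so $f(x)$ is a well-defined formal power series with integer coefficients (the coefficient of $x^m$ is the sum of $\lfloor \alpha + \log_k(n+1) \rfloor$ over all $n \geq 0$ with $|\tau(n)| = m$). A formal power series is called rational if it is the power series expansion of a quotient $p(x)/q(x)$ of polynomials with $q(0) \neq 0$. A real number is rational if it belongs to $\mathbb{Q}$. *)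

theory Defs
  imports Complex_Main "HOL-Computational_Algebra.Computational_Algebra"
begin

definition repr_length :: "nat \<Rightarrow> nat \<Rightarrow> nat" where
  "repr_length k n = (if n = 0 then 0 else nat (\<lfloor>log (real k) (real n)\<rfloor> + 1))"

(* The formal sum over all n, grouped by exponent; the sums defining the coefficients
   are finite for k >= 2 by finite_repr_length_eq. Summands may be negative. *)
definition floor_log_series :: "nat \<Rightarrow> real \<Rightarrow> int fps" where
  "floor_log_series k \<alpha> =
     Abs_fps (\<lambda>m. \<Sum>n | repr_length k n = m. \<lfloor>\<alpha> + log (real k) (real (n + 1))\<rfloor>)"

definition rational_fps :: "'a::field fps \<Rightarrow> bool" where
  "rational_fps F \<longleftrightarrow>
     (\<exists>p q. poly q 0 \<noteq> 0 \<and> F = fps_of_poly p / fps_of_poly q)"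

definition fps_of_int_fps :: "int fps \<Rightarrow> 'a::ring_1 fps" where
  "fps_of_int_fps F = Abs_fps (\<lambda>m. of_int (fps_nth F m))"

lemma finite_repr_length_eq:
  assumes "k \<ge> 2"
  shows "finite {n. repr_length k n = m}"
proof (rule finite_subset)
  show "{n. repr_length k n = m} \<subseteq> {..k ^ m}"
  proof
    fix n assume "n \<in> {n. repr_length k n = m}"
    then have m: "repr_length k n = m" by simp
    show "n \<in> {..k ^ m}"
    proof (cases "n = 0")
      case False
      then have "log (real k) (real n) < real m"
        using m unfolding repr_length_def by (simp split: if_splits) linarith
      then have "real n < real k powr real m"
        using False assms by (subst (asm) log_less_iff) auto
      also have "\<dots> = real (k ^ m)"
        using assms by (simp add: powr_realpow)
      finally show ?thesis by simp
    qed simp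
  qed
qed simp

end

(* With a = floor \<alpha> and \<gamma> = k powr (a - \<alpha>), counting the n of length m that satisfy
   n + 1 \<ge> \<gamma> k^m shows that the series plus E = \<Sum> ceil (\<gamma> k^m) x^m is rational.  Now
   (1 - k x) E has bounded integer coefficients, so it is rational iff they are eventually
   periodic (pigeonhole on the states of the linear recurrence).  Up to sign
   these coefficients are the base-k digits of ceil \<gamma> - \<gamma>, so this happens iff \<gamma> is rational. *)

theory Submission
  imports Defs
begin

section \<open>Eventual periodicity of recurrent sequences\<close>

definition eventually_periodic :: "(nat \<Rightarrow> 'b) \<Rightarrow> bool" where
  "eventually_periodic s \<longleftrightarrow> (\<exists>T>0. \<exists>M. \<forall>m\<ge>M. s (m + T) = s m)"

text \<open>Pigeonhole on the windows of length \<open>d\<close>: with finitely many values there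
  are finitely many windows, so two of them coincide, and the recurrence carries this coincidence
  forward. The map \<open>h\<close> need not be linear; it serves both linear recurrences and the
  nonlinear remainder map of the digit expansion.\<close>

lemma eventually_periodic_recurrence:
  fixes s :: "nat \<Rightarrow> 'b"
  assumes rec: "\<And>m. m \<ge> M \<Longrightarrow> s (m + d) = h (map s [m..<m + d])"
    and fin: "finite (range s)"
  shows "eventually_periodic s"
proof -
  define S where "S m = map s [m..<m + d]" for m
  have "S ` {M..} \<subseteq> {xs. set xs \<subseteq> range s \<and> length xs = d}"
    by (auto simp: S_def)
  then have "finite (S ` {M..})"
    using finite_lists_length_eq[OF fin] finite_subset by blast
  then have "\<not> inj_on S {M..}"
    using finite_imageD infinite_Ici by blast
  then obtain i j where ij: "M \<le> i" "i < j" "S i = S j"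
    unfolding inj_on_def by (metis atLeast_iff linorder_neqE_nat)
  \<comment> \<open>\<open>h\<close> does not depend on the index, so equal windows have equal next
    terms.\<close>
  have next_eq: "s (i + n + d) = s (j + n + d)" if "S (i + n) = S (j + n)" for n
    using rec[of "i + n"] rec[of "j + n"] that ij by (simp add: S_def)
  have S_Suc: "S (Suc m) = tl (S m @ [s (m + d)])" for m
  proof -
    have "S m @ [s (m + d)] = map s [m..<Suc (m + d)]" by (simp add: S_def)
    then show ?thesis by (simp add: S_def del: upt_Suc flip: map_tl)
  qed
  have "S (i + n) = S (j + n)" for n
  proof (induction n)
    case (Suc n)
    then show ?case using next_eq[OF Suc] by (simp add: S_Suc)
  qed (simp add: ij)
  then have *: "s (i + n + d) = s (j + n + d)" for n using next_eq by blast
  have "s (m + (j - i)) = s m" if "m \<ge> i + d" for m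
    using *[of "m - i - d"] that ij by (simp add: algebra_simps)
  then show ?thesis
    unfolding eventually_periodic_def using ij by (metis zero_less_diff)
qed

section \<open>Closure properties of rational power series\<close>

text \<open>Since \<open>q\<close> has nonzero constant term, its series is a unit and the
  denominator can be cleared. Closure properties then become ring identities without
  division.\<close>

lemma rational_fps_iff:
  "rational_fps F \<longleftrightarrow> (\<exists>p q. poly q 0 \<noteq> 0 \<and> fps_of_poly q * F = fps_of_poly p)"
proof -
  have "F = fps_of_poly p / fps_of_poly q \<longleftrightarrow> fps_of_poly q * F = fps_of_poly p"
    if "poly q 0 \<noteq> 0" for p q :: "'a poly"
  proof -
    have q: "fps_nth (fps_of_poly q) 0 \<noteq> 0" using that by (simp add: poly_0_coeff_0)
    then have inv: "fps_of_poly q * inverse (fps_of_poly q) = 1" by (rule inverse_mult_eq_1')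
    have "fps_of_poly q * (fps_of_poly p * inverse (fps_of_poly q)) = fps_of_poly p"
      by (simp only: mult.left_commute[of "fps_of_poly q"] inv mult_1_right)
    moreover have "fps_of_poly q * F * inverse (fps_of_poly q) = F"
      by (simp only: mult.commute[of "fps_of_poly q" F] mult.assoc inv mult_1_right)
    ultimately show ?thesis
      unfolding fps_divide_unit[OF q] by metis
  qed
  then show ?thesis unfolding rational_fps_def by blast
qed

lemma rational_fps_of_poly [simp]: "rational_fps (fps_of_poly p)"
  unfolding rational_fps_iff by (rule exI[of _ p], rule exI[of _ 1]) simp

lemma rational_fps_add:
  assumes "rational_fps F" "rational_fps G"
  shows "rational_fps (F + G)"
proof -
  obtain p q p' q' where
    "poly q 0 \<noteq> 0" "fps_of_poly q * F = fps_of_poly p"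
    "poly q' 0 \<noteq> 0" "fps_of_poly q' * G = fps_of_poly p'"
    using assms unfolding rational_fps_iff by metis
  moreover from this have "fps_of_poly (q * q') * (F + G) = fps_of_poly (q' * p + q * p')"
    by (simp add: fps_of_poly_mult fps_of_poly_add algebra_simps)
  ultimately show ?thesis unfolding rational_fps_iff by (metis mult_eq_0_iff poly_mult)
qed

lemma rational_fps_mult:
  assumes "rational_fps F" "rational_fps G"
  shows "rational_fps (F * G)"
proof -
  obtain p q p' q' where
    pq: "poly q 0 \<noteq> 0" "fps_of_poly q * F = fps_of_poly p"
    "poly q' 0 \<noteq> 0" "fps_of_poly q' * G = fps_of_poly p'"
    using assms unfolding rational_fps_iff by metis
  have "fps_of_poly (q * q') * (F * G) = (fps_of_poly q * F) * (fps_of_poly q' * G)"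
    by (simp add: fps_of_poly_mult algebra_simps)
  also have "\<dots> = fps_of_poly (p * p')" by (simp add: pq fps_of_poly_mult)
  finally show ?thesis
    unfolding rational_fps_iff using pq by (metis mult_eq_0_iff poly_mult)
qed

lemma rational_fps_const [simp]: "rational_fps (fps_const c)"
  using rational_fps_of_poly[of "[:c:]"] by (simp only: fps_of_poly_const)

lemma rational_fps_diff:
  assumes "rational_fps F" "rational_fps G"
  shows "rational_fps (F - G)"
proof -
  have "F - G = F + fps_const (- 1) * G"
    by (rule fps_ext) simp
  then show ?thesis
    using assms by (simp only: rational_fps_add rational_fps_mult rational_fps_const)
qed

text \<open>This allows passing from a series to its product with \<open>1 - c x\<close> and back
  without affecting rationality.\<close>

lemma rational_fps_poly_mult_iff:
  assumes "poly q 0 \<noteq> 0"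
  shows "rational_fps (fps_of_poly q * F) \<longleftrightarrow> rational_fps F"
proof
  assume "rational_fps (fps_of_poly q * F)"
  then obtain p r where "poly r 0 \<noteq> 0" "fps_of_poly r * (fps_of_poly q * F) = fps_of_poly p"
    unfolding rational_fps_iff by blast
  then show "rational_fps F"
    unfolding rational_fps_iff using assms
    by (intro exI[of _ p] exI[of _ "r * q"]) (simp add: fps_of_poly_mult mult.assoc)
qed (simp add: rational_fps_mult)

lemma fps_nth_one_minus_X_mult:
  "fps_nth (fps_of_poly [:1, - c:] * F) m =
     fps_nth F m - (if m = 0 then 0 else c * fps_nth F (m - 1))"
  for F :: "'a::comm_ring_1 fps"
proof -
  have "fps_of_poly [:1, - c:] = 1 - fps_X * fps_const c"
    by (simp add: fps_of_poly_pCons mult.commute flip: fps_const_neg)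
  then have "fps_of_poly [:1, - c:] * F = F - fps_X * (fps_const c * F)"
    by (simp only: left_diff_distrib mult.assoc mult_1)
  then show ?thesis by simp
qed

lemma rational_fps_geometric: "rational_fps (Abs_fps (\<lambda>m. c ^ m))"
proof -
  have "fps_of_poly [:1, - c:] * Abs_fps (\<lambda>m. c ^ m) = 1"
    by (rule fps_ext) (auto simp: fps_nth_one_minus_X_mult simp flip: power_Suc)
  then show ?thesis
    using rational_fps_poly_mult_iff[of "[:1, - c:]" "Abs_fps (\<lambda>m. c ^ m)"]
    by (metis fps_of_poly_1 one_neq_zero poly_pCons mult_zero_left add_0_right
        rational_fps_of_poly)
qed

lemma rational_fps_index_geometric: "rational_fps (Abs_fps (\<lambda>m. of_nat m * c ^ m))"
proof -
  \<comment> \<open>For m > 0 the coefficient is \<open>m * c ^ m - (m - 1) * c ^ m = c ^ m\<close>.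
    At index 0 it is 0, whence the subtracted constant 1.\<close>
  have "fps_of_poly [:1, - c:] * Abs_fps (\<lambda>m. of_nat m * c ^ m) =
        Abs_fps (\<lambda>m. c ^ m) - fps_const 1"
    (is "_ = ?R")
  proof (rule fps_ext)
    show "fps_nth (fps_of_poly [:1, - c:] * Abs_fps (\<lambda>m. of_nat m * c ^ m)) m = fps_nth ?R m" for m
      by (cases m) (simp_all add: fps_nth_one_minus_X_mult algebra_simps)
  qed
  moreover have "rational_fps ?R"
    by (intro rational_fps_diff rational_fps_geometric rational_fps_const)
  ultimately show ?thesis
    using rational_fps_poly_mult_iff[of "[:1, - c:]" "Abs_fps (\<lambda>m. of_nat m * c ^ m)"]
    by simp
qed

section \<open>Linear recurrences and series with finitely many coefficients\<close>

text \<open>Beyond the degree of the numerator \<open>p\<close> the coefficients of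
  \<open>q * F = p\<close> vanish, and each such equation can be solved for its newest coefficient
  because \<open>coeff q 0\<close> is nonzero.\<close>

lemma rational_fps_imp_linear_recurrence:
  assumes "rational_fps F"
  obtains c d M where
    "\<And>m. m \<ge> M \<Longrightarrow> fps_nth F (m + d) = (\<Sum>i<d. c i * fps_nth F (m + i))"
proof -
  obtain p q where q: "poly q 0 \<noteq> 0" and eq: "fps_of_poly q * F = fps_of_poly p"
    using assms unfolding rational_fps_iff by blast
  define d where "d = degree q"
  have q0: "coeff q 0 \<noteq> 0" using q by (simp add: poly_0_coeff_0)
  have "fps_nth F (m + d) = (\<Sum>i<d. (- coeff q (d - i) / coeff q 0) * fps_nth F (m + i))"
    if "m \<ge> Suc (degree p)" for m
  proof -
    have "0 = fps_nth (fps_of_poly q * F) (m + d)"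
      using that by (simp add: eq coeff_eq_0)
    also have "\<dots> = (\<Sum>i=0..m + d. coeff q i * fps_nth F (m + d - i))"
      by (simp add: fps_mult_nth)
    also have "\<dots> = (\<Sum>i=0..d. coeff q i * fps_nth F (m + d - i))"
      by (rule sum.mono_neutral_right) (auto simp: d_def coeff_eq_0)
    \<comment> \<open>Reversing the index puts \<open>fps_nth F (m + d)\<close>, with factor
      \<open>coeff q 0\<close>, at the end of the sum, ready to be split off.\<close>
    also have "\<dots> = (\<Sum>i=0..d. coeff q (d - i) * fps_nth F (m + i))"
      by (rule sum.reindex_bij_witness[of _ "\<lambda>i. d - i" "\<lambda>i. d - i"]) auto
    also have "\<dots> = (\<Sum>i<Suc d. coeff q (d - i) * fps_nth F (m + i))"
      by (rule sum.cong) auto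
    also have "\<dots> = (\<Sum>i<d. coeff q (d - i) * fps_nth F (m + i)) + coeff q 0 * fps_nth F (m + d)"
      by simp
    finally have "coeff q 0 * fps_nth F (m + d) =
        - (\<Sum>i<d. coeff q (d - i) * fps_nth F (m + i))"
      by (simp add: eq_neg_iff_add_eq_0 add.commute)
    then have "fps_nth F (m + d) =
        - (\<Sum>i<d. coeff q (d - i) * fps_nth F (m + i)) / coeff q 0"
      using q0 by (metis nonzero_mult_div_cancel_left)
    then show ?thesis
      by (simp add: sum_divide_distrib sum_negf)
  qed
  then show ?thesis by (rule that)
qed

lemma rational_fps_finite_range_iff:
  assumes "finite (range (fps_nth F))"
  shows "rational_fps F \<longleftrightarrow> eventually_periodic (fps_nth F)"
proof
  assume "rational_fps F"
  then obtain c d M where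
    rec: "\<And>m. m \<ge> M \<Longrightarrow> fps_nth F (m + d) = (\<Sum>i<d. c i * fps_nth F (m + i))"
    by (rule rational_fps_imp_linear_recurrence) blast
  show "eventually_periodic (fps_nth F)"
  proof (rule eventually_periodic_recurrence[OF _ assms])
    fix m assume "m \<ge> M"
    then show "fps_nth F (m + d) = (\<lambda>xs. \<Sum>i<d. c i * xs ! i) (map (fps_nth F) [m..<m + d])"
      by (simp add: rec)
  qed
next
  assume "eventually_periodic (fps_nth F)"
  then obtain T M where T: "T > 0" and per: "\<And>m. m \<ge> M \<Longrightarrow> fps_nth F (m + T) = fps_nth F m"
    unfolding eventually_periodic_def by blast
  \<comment> \<open>Multiplication by \<open>1 - x^T\<close> subtracts the sequence shifted by one
    period, so every coefficient from \<open>M + T\<close> on vanishes and the product is its own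
    truncation, a polynomial.\<close>
  define q :: "'a poly" where "q = 1 - monom 1 T"
  have q: "poly q 0 \<noteq> 0" using T by (simp add: q_def poly_monom power_0_left)
  have coef: "fps_nth (fps_of_poly q * F) m = fps_nth F m - (if m < T then 0 else fps_nth F (m - T))"
    for m
    by (simp add: q_def fps_of_poly_diff fps_of_poly_monom' left_diff_distrib fps_X_power_mult_nth)
  have "fps_of_poly q * F = fps_of_poly (\<Sum>i<M + T. monom (fps_nth (fps_of_poly q * F) i) i)"
  proof (rule fps_ext)
    fix m
    show "fps_nth (fps_of_poly q * F) m =
      fps_nth (fps_of_poly (\<Sum>i<M + T. monom (fps_nth (fps_of_poly q * F) i) i)) m"
    proof (cases "m < M + T")
      case False
      then have "fps_nth (fps_of_poly q * F) m = 0"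
        using per[of "m - T"] by (simp add: coef)
      then show ?thesis using False by (simp add: coeff_sum)
    qed (simp add: coeff_sum)
  qed
  then show "rational_fps F" unfolding rational_fps_iff using q by blast
qed

section \<open>Digits of the ceilings and rationality of \<gamma>\<close>

definition scaled_ceiling :: "nat \<Rightarrow> real \<Rightarrow> nat \<Rightarrow> int" where
  "scaled_ceiling k \<gamma> m = \<lceil>\<gamma> * real k ^ m\<rceil>"

text \<open>For \<open>m > 0\<close> this is minus the \<open>m\<close>-th base-\<open>k\<close> digit of \<open>\<lceil>\<gamma>\<rceil> - \<gamma>\<close>.\<close>

definition ceiling_digit :: "nat \<Rightarrow> real \<Rightarrow> nat \<Rightarrow> int" where
  "ceiling_digit k \<gamma> m =
     scaled_ceiling k \<gamma> m - (if m = 0 then 0 else int k * scaled_ceiling k \<gamma> (m - 1))"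

text \<open>The next digit is a function of the remainder
  \<open>scaled_ceiling k \<gamma> m - \<gamma> * real k ^ m\<close> alone, which lies in [0, 1).
  Bounds and periodicity of the remainders thus pass to the digits.\<close>

lemma ceiling_digit_Suc_eq:
  "ceiling_digit k \<gamma> (Suc m) =
     \<lceil>- real k * (real_of_int (scaled_ceiling k \<gamma> m) - \<gamma> * real k ^ m)\<rceil>"
proof -
  have "\<gamma> * real k ^ Suc m = - real k * (real_of_int (scaled_ceiling k \<gamma> m) - \<gamma> * real k ^ m)
          + real_of_int (int k * scaled_ceiling k \<gamma> m)"
    by (simp add: algebra_simps)
  then have "\<lceil>\<gamma> * real k ^ Suc m\<rceil> =
      \<lceil>- real k * (real_of_int (scaled_ceiling k \<gamma> m) - \<gamma> * real k ^ m)\<rceil>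
        + int k * scaled_ceiling k \<gamma> m"
    by (metis ceiling_add_of_int)
  then show ?thesis by (simp add: ceiling_digit_def scaled_ceiling_def)
qed

lemma finite_range_ceiling_digit: "finite (range (ceiling_digit k \<gamma>))"
proof -
  \<comment> \<open>Index 0 is listed separately: its entry is the ceiling of \<gamma> itself, not a
    digit.\<close>
  have "ceiling_digit k \<gamma> m \<in> insert (ceiling_digit k \<gamma> 0) {- int k..0}" for m
  proof (cases m)
    case (Suc n)
    define r where "r = real_of_int (scaled_ceiling k \<gamma> n) - \<gamma> * real k ^ n"
    have r: "0 \<le> r" "r \<le> 1"
      unfolding r_def scaled_ceiling_def by linarith+
    have "- real k * r \<le> 0" using r by simp
    moreover have "real k * r \<le> real k" using r by (simp add: mult_left_le)
    ultimately have "\<lceil>- real k * r\<rceil> \<in> {- int k..0}"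
      by (simp add: le_ceiling_iff ceiling_le_iff)
    then show ?thesis by (simp add: Suc ceiling_digit_Suc_eq r_def)
  qed simp
  then have "range (ceiling_digit k \<gamma>) \<subseteq> insert (ceiling_digit k \<gamma> 0) {- int k..0}"
    by blast
  then show ?thesis by (rule finite_subset) simp
qed

text \<open>If \<gamma> = p / q, every remainder is a multiple of 1 / q in [0, 1], so only finitely
  many occur. Each determines the next, as in long division, so they repeat.\<close>

lemma rational_imp_eventually_periodic_ceiling_digit:
  assumes "\<gamma> \<in> \<rat>"
  shows "eventually_periodic (ceiling_digit k \<gamma>)"
proof -
  obtain p q where q: "q > 0" and \<gamma>: "\<gamma> = of_int p / of_int q"
    using assms by (elim Rats_cases') auto
  define r where "r m = real_of_int (scaled_ceiling k \<gamma> m) - \<gamma> * real k ^ m" for m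
  have r_Suc: "r (Suc m) = real k * r m + of_int \<lceil>- real k * r m\<rceil>" for m
    using ceiling_digit_Suc_eq[of k \<gamma> m]
    by (simp add: r_def ceiling_digit_def algebra_simps)
  have "r m \<in> (\<lambda>i. of_int i / of_int q) ` {0..q}" for m
  proof -
    have bounds: "0 \<le> r m" "r m \<le> 1"
      unfolding r_def scaled_ceiling_def by linarith+
    define i where "i = q * scaled_ceiling k \<gamma> m - p * int k ^ m"
    have i: "r m = of_int i / of_int q"
      using q by (simp add: r_def i_def \<gamma> field_simps)
    then have "0 \<le> real_of_int i / of_int q" "real_of_int i / of_int q \<le> 1"
      using bounds by simp_all
    then have "0 \<le> i" "i \<le> q" using q by (simp_all add: zero_le_divide_iff)
    then show ?thesis using i by auto
  qed
  then have "range r \<subseteq> (\<lambda>i. of_int i / of_int q) ` {0..q}" by blast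
  then have "finite (range r)" by (rule finite_subset) simp
  then have "eventually_periodic r"
    by (intro eventually_periodic_recurrence
          [where d = 1 and M = 0 and h = "\<lambda>xs. real k * hd xs + of_int \<lceil>- real k * hd xs\<rceil>"])
       (simp_all add: r_Suc)
  then obtain T M where T: "T > 0" and per: "\<And>m. m \<ge> M \<Longrightarrow> r (m + T) = r m"
    unfolding eventually_periodic_def by blast
  \<comment> \<open>The digit at \<open>Suc n\<close> comes from the remainder at \<open>n\<close>,
    so the period of the remainders carries over one index later.\<close>
  have "ceiling_digit k \<gamma> (m + T) = ceiling_digit k \<gamma> m" if m: "m \<ge> Suc M" for m
  proof -
    obtain n where n: "m = Suc n" "n \<ge> M" using m by (cases m) auto
    then show ?thesis
      using per[of n] ceiling_digit_Suc_eq[of k \<gamma> n] ceiling_digit_Suc_eq[of k \<gamma> "n + T"]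
      by (simp add: r_def)
  qed
  then show ?thesis unfolding eventually_periodic_def using T by blast
qed

text \<open>Under periodic digits, the difference of two remainders one period apart is multiplied
  by \<open>k\<close> at each step. Remainders lie in [0, 1), so the difference must be 0, and
  equality of two remainders is a linear equation for \<gamma> with integer coefficients.\<close>

lemma eventually_periodic_ceiling_digit_imp_rational:
  assumes "k \<ge> 2" "eventually_periodic (ceiling_digit k \<gamma>)"
  shows "\<gamma> \<in> \<rat>"
proof -
  obtain T M where T: "T > 0"
    and per: "\<And>m. m \<ge> M \<Longrightarrow> ceiling_digit k \<gamma> (m + T) = ceiling_digit k \<gamma> m"
    using assms unfolding eventually_periodic_def by blast
  define r where "r m = real_of_int (scaled_ceiling k \<gamma> m) - \<gamma> * real k ^ m" for m
  have bounds: "0 \<le> r m" "r m < 1" for m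
    unfolding r_def scaled_ceiling_def by linarith+
  have r_Suc: "r (Suc m) = real k * r m + of_int (ceiling_digit k \<gamma> (Suc m))" for m
    by (simp add: r_def ceiling_digit_def algebra_simps)
  \<comment> \<open>Equal digits cancel in the difference of the two recurrences.\<close>
  have gap: "r (M + n + T) - r (M + n) = real k ^ n * (r (M + T) - r M)" for n
  proof (induction n)
    case (Suc n)
    have "r (M + Suc n + T) - r (M + Suc n) = real k * (r (M + n + T) - r (M + n))"
      using per[of "Suc (M + n)"] by (simp add: r_Suc algebra_simps)
    then show ?case by (simp add: Suc)
  qed simp
  have "r (M + T) = r M"
  proof (rule ccontr)
    assume "r (M + T) \<noteq> r M"
    then have pos: "\<bar>r (M + T) - r M\<bar> > 0" by simp
    obtain n where "1 / \<bar>r (M + T) - r M\<bar> < real k ^ n"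
      using real_arch_pow[of "real k"] assms by auto
    then have "1 < real k ^ n * \<bar>r (M + T) - r M\<bar>"
      using pos by (simp add: field_simps)
    then have "1 < \<bar>real k ^ n * (r (M + T) - r M)\<bar>"
      by (simp add: abs_mult)
    then show False
      using gap[of n] bounds[of "M + n"] bounds[of "M + n + T"] by linarith
  qed
  then have "\<gamma> * (real k ^ (M + T) - real k ^ M) =
      of_int (scaled_ceiling k \<gamma> (M + T) - scaled_ceiling k \<gamma> M)"
    by (simp add: r_def algebra_simps)
  moreover have "real k ^ (M + T) - real k ^ M \<noteq> 0"
    using assms T by simp
  ultimately have "\<gamma> = of_int (scaled_ceiling k \<gamma> (M + T) - scaled_ceiling k \<gamma> M) /
      (real k ^ (M + T) - real k ^ M)"
    by (simp add: field_simps)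
  also have "\<dots> \<in> \<rat>" by simp
  finally show ?thesis .
qed

lemma rational_fps_scaled_ceiling_iff:
  assumes "k \<ge> 2"
  shows "rational_fps (Abs_fps (\<lambda>m. of_int (scaled_ceiling k \<gamma> m)) :: 'a::field_char_0 fps)
           \<longleftrightarrow> \<gamma> \<in> \<rat>"
    (is "rational_fps ?E \<longleftrightarrow> _")
proof -
  define G :: "'a fps" where "G = Abs_fps (\<lambda>m. of_int (ceiling_digit k \<gamma> m))"
  have G: "fps_of_poly [:1, - of_nat k:] * ?E = G"
    by (rule fps_ext) (simp add: fps_nth_one_minus_X_mult G_def ceiling_digit_def)
  have "range (fps_nth G) = of_int ` range (ceiling_digit k \<gamma>)"
    by (auto simp: G_def)
  then have "finite (range (fps_nth G))" by (simp add: finite_range_ceiling_digit)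
  \<comment> \<open>In characteristic 0 \<open>of_int\<close> is injective, so periodicity in the
    field is periodicity of the integer digits.\<close>
  then have "rational_fps G \<longleftrightarrow> eventually_periodic (ceiling_digit k \<gamma>)"
    by (simp add: rational_fps_finite_range_iff) (simp add: eventually_periodic_def G_def)
  moreover have "rational_fps G \<longleftrightarrow> rational_fps ?E"
    using rational_fps_poly_mult_iff[of "[:1, - of_nat k:]" ?E] G by simp
  ultimately show ?thesis
    using eventually_periodic_ceiling_digit_imp_rational[OF assms]
      rational_imp_eventually_periodic_ceiling_digit by blast
qed

section \<open>Coefficients of the floor-log series\<close>

lemma repr_length_eq_0_iff:
  assumes "k \<ge> 2"
  shows "repr_length k n = 0 \<longleftrightarrow> n = 0"
proof -
  have "0 \<le> \<lfloor>log (real k) (real n)\<rfloor>" if "n \<noteq> 0" using assms that by simp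
  then show ?thesis unfolding repr_length_def by (cases "n = 0") (auto simp del: zero_le_floor)
qed

lemma repr_length_eq_Suc_iff:
  assumes "k \<ge> 2"
  shows "repr_length k n = Suc m \<longleftrightarrow> k ^ m \<le> n \<and> n < k ^ Suc m"
proof (cases "n = 0")
  case False
  have "repr_length k n = Suc m \<longleftrightarrow> \<lfloor>log (real k) (real n)\<rfloor> = int m"
    using False by (auto simp: repr_length_def)
  also have "\<dots> \<longleftrightarrow> k ^ m \<le> n \<and> n < k ^ Suc m"
    using floor_log_nat_eq_powr_iff[of k n m] assms False by simp
  finally show ?thesis .
qed (use assms in \<open>auto simp: repr_length_def\<close>)

text \<open>With a the floor of \<alpha>, the logarithm lies in (m, m + 1] and \<alpha> in [a, a +
  1), so the sum lies strictly between a + m and a + m + 2. Its floor is the larger candidate a + m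
  + 1 exactly when N is at least \<open>k powr (a - \<alpha>) * k ^ Suc m\<close>. The range of N is
  that of \<open>n + 1\<close> as n runs over the numbers of length \<open>Suc m\<close>.\<close>

lemma floor_add_log_eq:
  fixes k m N :: nat and \<alpha> :: real
  assumes k: "k \<ge> 2" and N: "k ^ m < N" "N \<le> k ^ Suc m"
  shows "\<lfloor>\<alpha> + log (real k) (real N)\<rfloor> = \<lfloor>\<alpha>\<rfloor> + int m +
    (if scaled_ceiling k (real k powr (of_int \<lfloor>\<alpha>\<rfloor> - \<alpha>)) (Suc m) \<le> int N then 1 else 0)"
proof -
  define a where "a = \<lfloor>\<alpha>\<rfloor>"
  have pos: "real N > 0" using N by simp
  have "real m < log (real k) (real N)"
    using N k pos by (subst less_log_iff) (simp_all add: powr_realpow flip: of_nat_power)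
  moreover have "log (real k) (real N) \<le> real (Suc m)"
    using N k pos by (subst log_le_iff) (simp_all add: powr_realpow del: power_Suc of_nat_Suc flip: of_nat_power)
  moreover have a: "of_int a \<le> \<alpha>" "\<alpha> < of_int a + 1" by (simp_all add: a_def)
  moreover have "scaled_ceiling k (real k powr (of_int a - \<alpha>)) (Suc m) \<le> int N
      \<longleftrightarrow> of_int a + real (Suc m) \<le> \<alpha> + log (real k) (real N)"
  proof -
    have "scaled_ceiling k (real k powr (of_int a - \<alpha>)) (Suc m) \<le> int N
        \<longleftrightarrow> real k powr (of_int a - \<alpha>) * real k powr real (Suc m) \<le> real N"
      using k by (simp add: scaled_ceiling_def ceiling_le_iff powr_realpow
          del: power_Suc of_nat_Suc)
    also have "\<dots> \<longleftrightarrow> of_int a - \<alpha> + real (Suc m) \<le> log (real k) (real N)"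
      using k pos by (simp add: le_log_iff powr_add)
    finally show ?thesis by linarith
  qed
  ultimately show ?thesis
    unfolding a_def[symmetric] by (simp add: floor_eq_iff)
qed

lemma fps_nth_floor_log_series_0:
  assumes "k \<ge> 2"
  shows "fps_nth (floor_log_series k \<alpha>) 0 = \<lfloor>\<alpha>\<rfloor>"
  using assms by (simp add: floor_log_series_def repr_length_eq_0_iff)

text \<open>Each n of length \<open>Suc m\<close> contributes a + m, and one more if
  \<open>n + 1\<close> reaches the threshold e; the number of the latter is
  \<open>k ^ Suc m + 1 - e\<close>.\<close>

lemma fps_nth_floor_log_series_Suc:
  fixes k m :: nat and \<alpha> :: real
  assumes k: "k \<ge> 2"
  shows "fps_nth (floor_log_series k \<alpha>) (Suc m) =
    (\<lfloor>\<alpha>\<rfloor> + int m) * (int k ^ Suc m - int k ^ m) + int k ^ Suc m + 1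
      - scaled_ceiling k (real k powr (of_int \<lfloor>\<alpha>\<rfloor> - \<alpha>)) (Suc m)"
proof -
  define a where "a = \<lfloor>\<alpha>\<rfloor>"
  define \<gamma> where "\<gamma> = real k powr (of_int a - \<alpha>)"
  define e where "e = scaled_ceiling k \<gamma> (Suc m)"
  have a: "of_int a \<le> \<alpha>" "\<alpha> < of_int a + 1" by (simp_all add: a_def)
  \<comment> \<open>From 0 \<le> \<alpha> - a < 1 follows 1/k < \<gamma> \<le> 1, hence
    \<open>k ^ m < e\<close> and \<open>e \<le> k ^ Suc m\<close>: the threshold falls inside the
    block, so the count needs no truncation.\<close>
  have "\<gamma> \<le> real k powr 0" unfolding \<gamma>_def using a k by (intro powr_mono) auto
  then have \<gamma>1: "\<gamma> \<le> 1" using k by simp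
  have "real k powr (- 1) < \<gamma>" unfolding \<gamma>_def using a k by (intro powr_less_mono) auto
  then have \<gamma>k: "1 < \<gamma> * real k" using k by (simp add: powr_minus field_simps)
  have "\<gamma> * real k ^ Suc m \<le> real k ^ Suc m" using \<gamma>1 by (simp add: mult_left_le_one_le \<gamma>_def)
  then have e_le: "e \<le> int k ^ Suc m"
    unfolding e_def scaled_ceiling_def by (simp add: ceiling_le_iff)
  have "real k ^ m * 1 < real k ^ m * (\<gamma> * real k)"
    using \<gamma>k k by (intro mult_strict_left_mono) auto
  then have "of_int (int k ^ m) < \<gamma> * real k ^ Suc m" by (simp add: algebra_simps)
  then have e_gt: "int k ^ m < e"
    unfolding e_def scaled_ceiling_def by (simp only: less_ceiling_iff)
  have e_pos: "e > 0" using e_gt by (smt (verit) zero_le_power of_nat_0_le_iff)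
  have "fps_nth (floor_log_series k \<alpha>) (Suc m) =
      (\<Sum>n\<in>{k ^ m..<k ^ Suc m}. \<lfloor>\<alpha> + log (real k) (real (n + 1))\<rfloor>)"
    unfolding floor_log_series_def
    by (simp del: power_Suc add: repr_length_eq_Suc_iff[OF k]) (rule sum.cong; auto)
  also have "\<dots> = (\<Sum>n\<in>{k ^ m..<k ^ Suc m}. a + int m + (if e \<le> int (n + 1) then 1 else 0))"
  proof (rule sum.cong[OF refl])
    fix n assume "n \<in> {k ^ m..<k ^ Suc m}"
    then have "k ^ m < n + 1" "n + 1 \<le> k ^ Suc m" by auto
    from floor_add_log_eq[OF k this]
    show "\<lfloor>\<alpha> + log (real k) (real (n + 1))\<rfloor> = a + int m + (if e \<le> int (n + 1) then 1 else 0)"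
      unfolding e_def \<gamma>_def a_def .
  qed
  also have "\<dots> = (a + int m) * int (card {k ^ m..<k ^ Suc m})
      + int (card ({k ^ m..<k ^ Suc m} \<inter> {n. e \<le> int (n + 1)}))"
    by (simp del: power_Suc card_atLeastLessThan add: sum.distrib sum.If_cases mult.commute)
  \<comment> \<open>As \<open>k ^ m < e\<close>, the threshold condition already implies the lower
    bound of the block; as e > 0, \<open>nat (e - 1)\<close> loses nothing.\<close>
  also have "{k ^ m..<k ^ Suc m} \<inter> {n. e \<le> int (n + 1)} = {nat (e - 1)..<k ^ Suc m}"
  proof -
    have "k ^ m \<le> n" if "e \<le> int (n + 1)" for n
    proof -
      have "int (k ^ m) < int (n + 1)" using e_gt that by simp
      then show ?thesis by linarith
    qed
    then show ?thesis using e_pos by (auto simp del: power_Suc)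
  qed
  also have "int (card {nat (e - 1)..<k ^ Suc m}) = int k ^ Suc m + 1 - e"
    using e_le e_pos by (simp del: power_Suc add: nat_le_iff of_nat_diff)
  also have "int (card {k ^ m..<k ^ Suc m}) = int k ^ Suc m - int k ^ m"
    using k by (simp del: power_Suc add: of_nat_diff power_increasing)
  finally show ?thesis by (simp add: e_def \<gamma>_def a_def)
qed

section \<open>Reduction of the series to the ceilings\<close>

text \<open>Adding the ceilings cancels the only irregular term of the coefficients. What remains
  for positive m is a combination of \<open>K ^ m\<close>, \<open>m * K ^ m\<close> and 1.\<close>

lemma rational_fps_floor_log_series_add_scaled_ceiling:
  fixes k :: nat and \<alpha> :: real
  assumes k: "k \<ge> 2"
  shows "rational_fps (fps_of_int_fps (floor_log_series k \<alpha>) +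
    Abs_fps (\<lambda>m. of_int (scaled_ceiling k (real k powr (of_int \<lfloor>\<alpha>\<rfloor> - \<alpha>)) m))
      :: 'a::field_char_0 fps)" (is "rational_fps ?H")
proof -
  define K :: 'a where "K = of_nat k"
  define a :: 'a where "a = of_int \<lfloor>\<alpha>\<rfloor>"
  have K: "K \<noteq> 0" using k by (simp add: K_def)
  \<comment> \<open>The constants come from expanding
    \<open>(a + m - 1) * (K ^ m - K ^ (m - 1)) + K ^ m + 1\<close> for m > 0, with
    \<open>K ^ (m - 1) = K ^ m / K\<close>.\<close>
  define R where "R = fps_const ((a - 1) * (1 - 1 / K) + 1) * Abs_fps (\<lambda>m. K ^ m)
      + fps_const (1 - 1 / K) * Abs_fps (\<lambda>m. of_nat m * K ^ m) + Abs_fps (\<lambda>m. 1 ^ m)"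
  have "rational_fps R"
    unfolding R_def by (intro rational_fps_add rational_fps_mult rational_fps_const
        rational_fps_geometric rational_fps_index_geometric)
  \<comment> \<open>The closed form is established only for positive indices; a constant series
    absorbs the discrepancy at index 0.\<close>
  moreover have "?H = fps_const (fps_nth ?H 0 - fps_nth R 0) + R"
  proof (rule fps_ext)
    fix m
    show "fps_nth ?H m = fps_nth (fps_const (fps_nth ?H 0 - fps_nth R 0) + R) m"
    proof (cases m)
      case (Suc n)
      have "fps_nth ?H m = (a + of_nat n) * (K ^ Suc n - K ^ n) + K ^ Suc n + 1"
        by (simp add: Suc fps_of_int_fps_def fps_nth_floor_log_series_Suc[OF k] a_def K_def)
      also have "\<dots> = fps_nth R m"
        using K by (simp add: Suc R_def field_simps)
      finally show ?thesis by (simp add: Suc)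
    qed simp
  qed
  ultimately show ?thesis by (metis rational_fps_add rational_fps_const)
qed

theorem mainTheorem1:
  fixes k :: nat and \<alpha> :: real
  assumes "k \<ge> 2"
  shows "rational_fps (fps_of_int_fps (floor_log_series k \<alpha>) :: 'a::field_char_0 fps)
           \<longleftrightarrow> real k powr \<alpha> \<in> \<rat>"
proof -
  define \<gamma> where "\<gamma> = real k powr (of_int \<lfloor>\<alpha>\<rfloor> - \<alpha>)"
  define F :: "'a fps" where "F = fps_of_int_fps (floor_log_series k \<alpha>)"
  define E :: "'a fps" where "E = Abs_fps (\<lambda>m. of_int (scaled_ceiling k \<gamma> m))"
  have FE: "rational_fps (F + E)"
    using rational_fps_floor_log_series_add_scaled_ceiling[OF assms] by (simp add: F_def E_def \<gamma>_def)
  \<comment> \<open>Each of F and E is the rational series F + E minus the other.\<close>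
  have "rational_fps F \<longleftrightarrow> rational_fps E"
    using rational_fps_diff[OF FE, of F] rational_fps_diff[OF FE, of E] by auto
  also have "\<dots> \<longleftrightarrow> \<gamma> \<in> \<rat>"
    unfolding E_def by (rule rational_fps_scaled_ceiling_iff[OF assms])
  also have "\<dots> \<longleftrightarrow> real k powr \<alpha> \<in> \<rat>"
  proof -
    \<comment> \<open>The exponent is an integer, so this power is rational; \<gamma> and
      \<open>k powr \<alpha>\<close> are each this power divided by the other.\<close>
    have pw: "real k powr of_int \<lfloor>\<alpha>\<rfloor> \<in> \<rat>"
      using assms by (simp add: powr_real_of_int' power_int_def)
    have "\<gamma> = real k powr of_int \<lfloor>\<alpha>\<rfloor> / real k powr \<alpha>"
      "real k powr \<alpha> = real k powr of_int \<lfloor>\<alpha>\<rfloor> / \<gamma>"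
      using assms by (simp_all add: \<gamma>_def powr_diff)
    then show ?thesis using pw by (metis Rats_divide)
  qed
  finally show ?thesis by (simp add: F_def)
qed

end
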